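(* For every fixed integer $m\ge2$ there is a constant $C_m\ge0$ such that, for all $K\ge2$, $$\sum_{2\le k\le K}|E_k|^m\le\sum_{2\le k\le K}a_k^m\ll_m K(\log K)^{C_m}.$$
   Context: $\tau(n)$ is the number of positive divisors of $n$; $\log$ is the natural logarithm. For $k\ge2$, $$E_k=\{\tau(k^2-j)-j:\ 1\le j\le 2k-2,\ \tau(k^2-j)\ge j\},$$ $$a_k=\#\{1\le j\le 2k-2:\ \tau(k^2-j)\ge j\}.$$ *)

theory Defs
  imports Complex_Main
begin

definition tau :: "nat \<Rightarrow> nat" where
  "tau n = card {d. d dvd n}"

text \<open>For \<open>k \<ge> 2\<close> and \<open>1 \<le> j \<le> 2 * k - 2\<close> we have \<open>k\<^sup>2 - j > (k - 1)\<^sup>2\<close>, so none of the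
  truncated subtractions on natural numbers below actually truncates.\<close>

definition J :: "nat \<Rightarrow> nat set" where
  "J k = {j. 1 \<le> j \<and> j \<le> 2 * k - 2 \<and> tau (k\<^sup>2 - j) \<ge> j}"

definition E :: "nat \<Rightarrow> int set" where
  "E k = {int (tau (k\<^sup>2 - j)) - int j | j. j \<in> J k}"

definition a :: "nat \<Rightarrow> nat" where
  "a k = card (J k)"

end

theory Submission
  imports Defs "HOL-Computational_Algebra.Primes"
begin

text \<open>
  If \<open>A\<close> is a finite set of positive integers then \<open>(card A)\<^sup>m \<le> m * (\<Sum>j\<in>A. j\<^sup>m\<^sup>-\<^sup>1)\<close>, because the
  worst case is \<open>A = {1..card A}\<close>. On the set that \<open>a k\<close> counts one has \<open>tau (k\<^sup>2 - j) \<ge> j\<close>, so any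
  power of \<open>tau (k\<^sup>2 - j) / j\<close> may be inserted as a factor, and it follows that
  \<open>(a k)\<^sup>m \<le> m * (\<Sum>1 \<le> j < k\<^sup>2. tau (k\<^sup>2 - j)\<^sup>m\<^sup>+\<^sup>2 / j\<^sup>3)\<close>. The weight \<open>j\<^sup>-\<^sup>3\<close> leaves so much room that a
  moment bound for \<open>tau (k\<^sup>2 - j)\<close> over \<open>k\<close> may lose a factor \<open>j\<close>
  (\<open>sum_tau_power_shifted_squares\<close>). This absorbs the effect of square factors of \<open>j\<close>, which give
  \<open>k\<^sup>2 \<equiv> j (mod d)\<close> unusually many solutions.

  For the moment bound, two facts are combined. First, every \<open>n > 0\<close> has a divisor \<open>d \<le> \<surd>n\<close> with
  \<open>tau n \<le> 2 * (tau d)\<^sup>2\<close> (\<open>ex_small_divisor_tau\<close>), so a power of \<open>tau n\<close> is dominated by a sum of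
  powers of \<open>tau d\<close> over the divisors \<open>d \<le> \<surd>n\<close>. For \<open>n = k\<^sup>2 - j\<close> with \<open>k \<le> x\<close> only moduli
  \<open>d \<le> x\<close> occur, for which the error terms in counting residue classes up to \<open>x\<close> are harmless.
  Second, the congruence \<open>k\<^sup>2 \<equiv> j (mod d)\<close> has at most \<open>3 * j * tau d * x / d\<close> solutions \<open>k \<le> x\<close>
  when \<open>d \<le> x\<close> (\<open>card_square_congruence_le\<close>). After exchanging the summations there remains
  \<open>\<Sum>d\<le>x. (tau d)\<^sup>M / d\<close>, which is at most \<open>(1 + ln x)\<close> to the power \<open>2\<^sup>M\<close>.
\<close>

section \<open>The divisor function\<close>

lemma tau_mult_le:
  assumes "r > 0" "s > 0"
  shows "tau (r * s) \<le> tau r * tau s"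
proof -
  have "{d. d dvd r * s} \<subseteq> (\<lambda>(x, y). x * y) ` ({d. d dvd r} \<times> {d. d dvd s})"
  proof
    fix d assume "d \<in> {d. d dvd r * s}"
    then obtain x y where "d = x * y" "x dvd r" "y dvd s"
      using division_decomp by blast
    then show "d \<in> (\<lambda>(x, y). x * y) ` ({d. d dvd r} \<times> {d. d dvd s})"
      by force
  qed
  then have "tau (r * s) \<le> card ({d. d dvd r} \<times> {d. d dvd s})"
    unfolding tau_def using assms by (intro surj_card_le) auto
  then show ?thesis
    by (simp add: tau_def card_cartesian_product)
qed

lemma tau_mult_coprime_ge:
  assumes "r > 0" "s > 0" "coprime r s"
  shows "tau r * tau s \<le> tau (r * s)"
proof -
  have "inj_on (\<lambda>(x, y). x * y) ({d. d dvd r} \<times> {d. d dvd s})"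
  proof (rule inj_onI, clarsimp)
    fix x y x' y' assume *: "x dvd r" "y dvd s" "x' dvd r" "y' dvd s" "x * y = x' * y'"
    have "coprime x y'" "coprime x' y"
      using * assms(3) by (meson coprime_divisors)+
    then show "x = x' \<and> y = y'"
      using * coprime_crossproduct_nat[of x y' x' y] by auto
  qed
  moreover have "(\<lambda>(x, y). x * y) ` ({d. d dvd r} \<times> {d. d dvd s}) \<subseteq> {d. d dvd r * s}"
    by (auto intro: mult_dvd_mono)
  ultimately have "card ({d. d dvd r} \<times> {d. d dvd s}) \<le> tau (r * s)"
    unfolding tau_def using assms by (intro card_inj_on_le) auto
  then show ?thesis
    by (simp add: tau_def card_cartesian_product)
qed

lemma tau_prime_power:
  assumes "prime p"
  shows "tau (p ^ e) = e + 1"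
proof -
  have "{d. d dvd p ^ e} = (\<lambda>i. p ^ i) ` {..e}"
    using assms by (auto simp: divides_primepow_nat)
  moreover have "inj_on (\<lambda>i. p ^ i) {..e}"
    using prime_gt_1_nat[OF assms] by (auto intro!: inj_onI)
  ultimately show ?thesis
    by (simp add: tau_def card_image)
qed

lemma tau_prime: "prime p \<Longrightarrow> tau p = 2"
  using tau_prime_power[of p 1] by simp

text \<open>
  Prime powers are halved and the simple prime factors are paired: from \<open>p\<^sup>e\<close> with \<open>e \<ge> 2\<close> the
  divisor receives \<open>p\<close> to the power \<open>e div 2\<close>, and from two simple primes it receives the smaller
  one. Either way the divisor stays below the square root and the square of its \<open>tau\<close> grows at
  least as fast as \<open>tau n\<close>. The factor \<open>2\<close> pays for a simple prime that remains unpaired.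
\<close>

lemma ex_small_divisor_tau:
  "n > 0 \<Longrightarrow> \<exists>d. d dvd n \<and> d\<^sup>2 \<le> n \<and> tau n \<le> 2 * (tau d)\<^sup>2"
proof (induction n rule: less_induct)
  case (less n)
  show ?case
  proof (cases "\<exists>p. prime p \<and> p\<^sup>2 dvd n")
    case True
    then obtain p where p: "prime p" "p\<^sup>2 dvd n" by blast
    have p1: "p > 1" using p(1) prime_gt_1_nat by blast
    define e where "e = multiplicity p n"
    obtain n' where n: "n = p ^ e * n'" and pn': "\<not> p dvd n'"
      using multiplicity_decompose'[of n p] less.prems p1 unfolding e_def by auto
    have e2: "e \<ge> 2"
      unfolding e_def using p less.prems p1
      by (intro multiplicity_geI) auto
    have n'0: "n' > 0" using n less.prems by (cases n') auto
    have "1 < p ^ e" using p1 e2 by (intro one_less_power) auto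
    then have "n' < n" using n n'0 by simp
    with less.IH n'0 obtain d' where d': "d' dvd n'" "d'\<^sup>2 \<le> n'" "tau n' \<le> 2 * (tau d')\<^sup>2"
      by blast
    define f where "f = e div 2"
    have f: "f \<ge> 1" "2 * f \<le> e" "e + 1 \<le> 2 * f + 2" using e2 unfolding f_def by auto
    have ef: "e + 1 \<le> (f + 1)\<^sup>2"
    proof -
      have "2 * f + 2 \<le> (f + 1)\<^sup>2"
        using f(1) by (simp add: power2_eq_square)
      with f(3) show ?thesis by linarith
    qed
    have d'0: "d' > 0" using d'(1) n'0 by (auto intro: Nat.gr0I)
    have cop: "coprime (p ^ f) d'"
      using pn' d'(1) p(1) by (meson coprime_power_left_iff dvd_trans prime_imp_coprime)
    have "tau n \<le> (e + 1) * tau n'"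
      using tau_mult_le[of "p ^ e" n'] n n'0 p1 tau_prime_power[OF p(1)] by simp
    also have "\<dots> \<le> (f + 1)\<^sup>2 * (2 * (tau d')\<^sup>2)"
      using ef d'(3) by (rule mult_le_mono)
    also have "\<dots> = 2 * ((f + 1) * tau d')\<^sup>2"
      by (simp only: power_mult_distrib ac_simps)
    also have "\<dots> \<le> 2 * (tau (p ^ f * d'))\<^sup>2"
      using tau_mult_coprime_ge[OF _ d'0 cop] p1 tau_prime_power[OF p(1), of f] by simp
    finally have "tau n \<le> 2 * (tau (p ^ f * d'))\<^sup>2" .
    moreover have "p ^ f * d' dvd n"
      unfolding n using d'(1) f by (intro mult_dvd_mono le_imp_power_dvd) auto
    moreover have "(p ^ f * d')\<^sup>2 \<le> n"
    proof -
      have "(p ^ f * d')\<^sup>2 = p ^ (2 * f) * d'\<^sup>2"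
        by (simp add: power_mult_distrib power_mult[symmetric] mult.commute)
      also have "\<dots> \<le> p ^ e * n'"
        using d'(2) f(2) p1 by (intro mult_le_mono power_increasing) auto
      finally show ?thesis using n by simp
    qed
    ultimately show ?thesis by blast
  next
    case False
    show ?thesis
    proof (cases "n = 1 \<or> prime n")
      case True
      then have "tau n \<le> 2 * (tau 1)\<^sup>2"
        using tau_prime by (auto simp: tau_def)
      with less.prems show ?thesis by (intro exI[of _ 1]) auto
    next
      case False2: False
      then obtain p where p: "prime p" "p dvd n"
        using prime_factor_nat by blast
      obtain r where r: "n = p * r" using p(2) by blast
      have "r \<noteq> 1" using r p(1) False2 by auto
      then obtain q where q: "prime q" "q dvd r"
        using prime_factor_nat by blast
      obtain n' where n': "r = q * n'" using q(2) by blast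
      define u where "u = min p q"
      have n: "n = p * q * n'" using r n' by simp
      have u: "prime u" unfolding u_def min_def using p q by simp
      have pq1: "p > 1" "q > 1" using p(1) q(1) prime_gt_1_nat by auto
      have n'0: "n' > 0" using n less.prems by (cases n') auto
      have un': "\<not> u dvd n'"
      proof
        assume "u dvd n'"
        then have "u * u dvd (p * q) * n'"
          by (intro mult_dvd_mono) (auto simp: u_def min_def)
        with n False u show False by (auto simp: power2_eq_square)
      qed
      have "1 < p * q" using pq1 by (rule less_1_mult)
      then have "n' < n" using n n'0 by simp
      with less.IH n'0 obtain d' where d': "d' dvd n'" "d'\<^sup>2 \<le> n'" "tau n' \<le> 2 * (tau d')\<^sup>2"
        by blast
      have d'0: "d' > 0" using d'(1) n'0 by (auto intro: Nat.gr0I)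
      have cop: "coprime u d'"
        using un' d'(1) u by (meson dvd_trans prime_imp_coprime)
      have "tau n \<le> tau (p * q) * tau n'"
        using tau_mult_le[of "p * q" n'] n n'0 pq1 by simp
      also have "\<dots> \<le> (tau p * tau q) * tau n'"
        using tau_mult_le[of p q] pq1 by (intro mult_le_mono) auto
      also have "\<dots> \<le> 4 * (2 * (tau d')\<^sup>2)"
        using tau_prime p q d'(3) by simp
      also have "\<dots> = 2 * (tau u * tau d')\<^sup>2"
        using tau_prime[OF u] by (simp add: power_mult_distrib)
      also have "\<dots> \<le> 2 * (tau (u * d'))\<^sup>2"
        using tau_mult_coprime_ge[OF _ d'0 cop] u prime_gt_0_nat by simp
      finally have "tau n \<le> 2 * (tau (u * d'))\<^sup>2" .
      moreover have "u * d' dvd n"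
        unfolding n using d'(1) by (intro mult_dvd_mono) (auto simp: u_def min_def)
      moreover have "(u * d')\<^sup>2 \<le> n"
      proof -
        have "u * u \<le> p * q" unfolding u_def by (intro mult_le_mono) auto
        then have "u * u * d'\<^sup>2 \<le> p * q * n'" using d'(2) by (rule mult_le_mono)
        then show ?thesis using n by (simp add: power2_eq_square ac_simps)
      qed
      ultimately show ?thesis by blast
    qed
  qed
qed

lemma tau_power_le_sum_small_divisors:
  assumes "n > 0"
  shows "real (tau n) ^ N \<le> 2 ^ N * (\<Sum>d | d dvd n \<and> d\<^sup>2 \<le> n. real (tau d) ^ (2 * N))"
proof -
  obtain d where d: "d dvd n" "d\<^sup>2 \<le> n" "tau n \<le> 2 * (tau d)\<^sup>2"
    using ex_small_divisor_tau[OF assms] by blast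
  have "real (tau n) ^ N \<le> (2 * (real (tau d))\<^sup>2) ^ N"
  proof (rule power_mono)
    have "real (tau n) \<le> real (2 * (tau d)\<^sup>2)" using d(3) by (rule of_nat_mono)
    then show "real (tau n) \<le> 2 * (real (tau d))\<^sup>2" by simp
  qed simp
  also have "\<dots> = 2 ^ N * real (tau d) ^ (2 * N)"
    by (simp add: power_mult_distrib power_mult)
  also have "\<dots> \<le> 2 ^ N * (\<Sum>d | d dvd n \<and> d\<^sup>2 \<le> n. real (tau d) ^ (2 * N))"
    using d assms by (intro mult_left_mono member_le_sum) auto
  finally show ?thesis .
qed

section \<open>Logarithmic means\<close>

lemma sum_inverse_le_ln:
  assumes "n \<ge> 1"
  shows "(\<Sum>d=1..n. 1 / real d) \<le> 1 + ln (real n)"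
  using assms
proof (induction n rule: dec_induct)
  case (step n)
  have n: "real n > 0" using step.hyps by simp
  have "ln (real n / real (Suc n)) \<le> real n / real (Suc n) - 1"
    using n by (intro ln_le_minus_one) auto
  also have "\<dots> = - (1 / real (Suc n))"
    by (simp add: field_simps)
  finally have "1 / real (Suc n) \<le> ln (real (Suc n)) - ln (real n)"
    using n by (simp add: ln_div)
  with step.IH show ?case by simp
qed simp

lemma sum_inverse_squares_le: "n \<ge> 1 \<Longrightarrow> (\<Sum>j=1..n. 1 / (real j)\<^sup>2) \<le> 2 - 1 / real n"
proof (induction n rule: dec_induct)
  case (step n)
  have "1 / (real (Suc n))\<^sup>2 \<le> 1 / real n - 1 / real (Suc n)"
  proof -
    have "1 / (real (Suc n))\<^sup>2 \<le> 1 / (real n * real (Suc n))"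
      using step.hyps by (intro divide_left_mono) (auto simp: power2_eq_square)
    also have "\<dots> = 1 / real n - 1 / real (Suc n)"
      using step.hyps by (simp add: field_simps)
    finally show ?thesis .
  qed
  with step.IH show ?case by simp
qed simp

text \<open>
  Writing one factor \<open>tau d\<close> as a sum over factorisations \<open>d = x * y\<close> and using
  submultiplicativity for the others bounds the mean of exponent \<open>M + 1\<close> by the square of the
  mean of exponent \<open>M\<close>.
\<close>

lemma sum_tau_power_over_le:
  assumes "n \<ge> 1"
  shows "(\<Sum>d=1..n. real (tau d) ^ M / real d) \<le> (1 + ln (real n)) ^ (2 ^ M)"
proof (induction M)
  case 0
  then show ?case using sum_inverse_le_ln[OF assms] by simp
next
  case (Suc M)
  define h where "h = (\<lambda>d. real (tau d) ^ M / real d)"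
  have h0: "h d \<ge> 0" for d unfolding h_def by simp
  have "(\<Sum>d=1..n. real (tau d) ^ Suc M / real d) = (\<Sum>d=1..n. \<Sum>x | x dvd d. h d)"
    by (intro sum.cong) (auto simp: h_def tau_def)
  also have "\<dots> = (\<Sum>(d, x) \<in> (SIGMA d:{1..n}. {x. x dvd d}). h d)"
    by (intro sum.Sigma) auto
  also have "\<dots> \<le> (\<Sum>(x, y) \<in> {1..n} \<times> {1..n}. h x * h y)"
  proof (rule sum_le_included[where i = "\<lambda>(x, y). (x * y, x)"])
    show "finite (SIGMA d:{1..n}. {x. x dvd d})" by auto
    show "\<forall>v\<in>SIGMA d:{1..n}. {x. x dvd d}. \<exists>w\<in>{1..n} \<times> {1..n}.
      (case w of (x, y) \<Rightarrow> (x * y, x)) = v \<and>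
      (case v of (d, x) \<Rightarrow> h d) \<le> (case w of (x, y) \<Rightarrow> h x * h y)"
    proof
      fix v assume "v \<in> (SIGMA d:{1..n}. {x. x dvd d})"
      then obtain d x where v: "v = (d, x)" "1 \<le> d" "d \<le> n" "x dvd d" by auto
      then obtain y where y: "d = x * y" by blast
      have pos: "x \<ge> 1" "y \<ge> 1" using v(2) y by (auto simp: Suc_le_eq intro: Nat.gr0I)
      have "x \<le> d" "y \<le> d" using y pos by auto
      then have "(x, y) \<in> {1..n} \<times> {1..n}" using pos v(3) by auto
      moreover have "h d \<le> h x * h y"
      proof -
        have "real (tau d) ^ M \<le> (real (tau x) * real (tau y)) ^ M"
          unfolding of_nat_mult[symmetric] using tau_mult_le[of x y] pos y
          by (intro power_mono of_nat_mono) auto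
        then show ?thesis
          unfolding h_def y using pos by (simp add: power_mult_distrib divide_right_mono)
      qed
      ultimately show "\<exists>w\<in>{1..n} \<times> {1..n}. (case w of (x, y) \<Rightarrow> (x * y, x)) = v \<and>
          (case v of (d, x) \<Rightarrow> h d) \<le> (case w of (x, y) \<Rightarrow> h x * h y)"
        using v y by (intro bexI[of _ "(x, y)"]) auto
    qed
  qed (auto simp: h0)
  also have "\<dots> = (\<Sum>d=1..n. h d)\<^sup>2"
    by (simp add: power2_eq_square sum_product sum.cartesian_product)
  also have "\<dots> \<le> ((1 + ln (real n)) ^ (2 ^ M))\<^sup>2"
    using Suc.IH unfolding h_def by (intro power_mono sum_nonneg) auto
  also have "\<dots> = (1 + ln (real n)) ^ (2 ^ Suc M)"
    by (simp add: power_mult[symmetric] mult.commute)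
  finally show ?case .
qed

section \<open>Quadratic congruences\<close>

lemma card_congruent_le:
  fixes L n :: nat
  assumes "L > 0" "T \<subseteq> {1..n}" "\<And>k l. k \<in> T \<Longrightarrow> l \<in> T \<Longrightarrow> int L dvd int k - int l"
  shows "card T \<le> n div L + 1"
proof -
  have "inj_on (\<lambda>k. k div L) T"
  proof (rule inj_onI)
    fix k l assume kl: "k \<in> T" "l \<in> T" "k div L = l div L"
    have "k mod L = l mod L"
      using assms(3)[OF kl(1,2)] by (metis mod_eq_dvd_iff of_nat_eq_iff of_nat_mod)
    with kl(3) show "k = l" by (metis div_mult_mod_eq)
  qed
  moreover have "(\<lambda>k. k div L) ` T \<subseteq> {..n div L}"
  proof clarify
    fix k assume "k \<in> T"
    then have "k \<le> n" using assms(2) by auto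
    then show "k div L \<le> n div L" by (rule div_le_mono)
  qed
  ultimately have "card T \<le> card {..n div L}"
    by (intro card_inj_on_le) auto
  then show ?thesis by simp
qed

text \<open>
  If \<open>g\<close> is the gcd of \<open>u\<close> and \<open>v\<close>, then \<open>g\<close> divides \<open>(k + l) - (k - l) = 2 * l\<close>, and \<open>g\<^sup>2\<close> divides
  \<open>u * v\<close>, hence \<open>l\<^sup>2 - j\<close>. So \<open>g\<^sup>2\<close> divides \<open>4 * j\<close>: the two congruences determine \<open>k\<close> modulo the
  least common multiple \<open>u * v / g\<close>, and \<open>g \<le> 2 * j\<close> limits what is lost against the modulus \<open>u * v\<close>.
\<close>

lemma card_split_congruence_le:
  fixes u v j n l :: nat
  assumes "j \<ge> 1" "u > 0" "v > 0" "u * v \<le> n"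
    and l: "int (u * v) dvd (int l)\<^sup>2 - int j"
  defines "T \<equiv> {k \<in> {1..n}. int u dvd int k - int l \<and> int v dvd int k + int l}"
  shows "real (card T) \<le> 3 * real j * real n / real (u * v)"
proof (cases "T = {}")
  case False
  then obtain k where k: "int u dvd int k - int l" "int v dvd int k + int l"
    unfolding T_def by auto
  define g where "g = gcd u v"
  define L where "L = lcm u v"
  have gL: "g * L = u * v" unfolding g_def L_def by (rule prod_gcd_lcm_nat[symmetric])
  have L0: "L > 0" unfolding L_def using assms by (simp add: lcm_pos_nat)
  have "int g dvd (int k + int l) - (int k - int l)"
  proof (rule dvd_diff)
    show "int g dvd int k + int l"
      using k(2) unfolding g_def by (meson dvd_trans gcd_dvd2 of_nat_dvd_iff)
    show "int g dvd int k - int l"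
      using k(1) unfolding g_def by (meson dvd_trans gcd_dvd1 of_nat_dvd_iff)
  qed
  then have "int g dvd 2 * int l" by simp
  then have "(int g)\<^sup>2 dvd (2 * int l)\<^sup>2" by (rule dvd_power_same)
  then have g4: "(int g)\<^sup>2 dvd 4 * (int l)\<^sup>2" unfolding power_mult_distrib by simp
  have "g\<^sup>2 dvd u * v"
    unfolding g_def power2_eq_square by (intro mult_dvd_mono) auto
  then have "int (g\<^sup>2) dvd int (u * v)"
    using of_nat_dvd_iff by blast
  then have "(int g)\<^sup>2 dvd 4 * ((int l)\<^sup>2 - int j)"
    using l by (metis dvd_mult dvd_trans of_nat_power)
  then have "(int g)\<^sup>2 dvd 4 * (int l)\<^sup>2 - 4 * ((int l)\<^sup>2 - int j)"
    using g4 by (intro dvd_diff)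
  then have "int (g\<^sup>2) dvd int (4 * j)" by (simp add: algebra_simps)
  then have "g\<^sup>2 dvd 4 * j" using of_nat_dvd_iff by blast
  then have "g\<^sup>2 \<le> 4 * j" using assms(1) by (intro dvd_imp_le) auto
  also have "\<dots> \<le> (2 * j)\<^sup>2" using assms(1) by (simp add: power2_eq_square)
  finally have g: "g \<le> 2 * j" by (rule power2_nat_le_eq_le[THEN iffD1])
  have "card T \<le> n div L + 1"
  proof (rule card_congruent_le[OF L0])
    show "T \<subseteq> {1..n}" unfolding T_def by auto
    fix k k' assume kk: "k \<in> T" "k' \<in> T"
    have "int u dvd (int k - int l) - (int k' - int l)"
      by (rule dvd_diff) (use kk in \<open>auto simp: T_def\<close>)
    moreover have "int v dvd (int k + int l) - (int k' + int l)"
      by (rule dvd_diff) (use kk in \<open>auto simp: T_def\<close>)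
    ultimately have "lcm (int u) (int v) dvd int k - int k'"
      by (intro lcm_least) auto
    then show "int L dvd int k - int k'" unfolding L_def by simp
  qed
  then have "real (card T) \<le> real (n div L) + 1" by linarith
  also have "\<dots> \<le> real n / real L + 1" by (simp add: of_nat_div_le_of_nat)
  also have "\<dots> = real g * real n / real (u * v) + 1"
    using gL L0 assms(2,3) by (simp add: field_simps flip: of_nat_mult)
  also have "\<dots> \<le> (2 * real j) * real n / real (u * v) + real j * real n / real (u * v)"
  proof (rule add_mono)
    show "real g * real n / real (u * v) \<le> (2 * real j) * real n / real (u * v)"
      using g by (intro divide_right_mono mult_right_mono) auto
    have "real (u * v) \<le> real n" using assms(4) by (rule of_nat_mono)
    also have "\<dots> \<le> real j * real n" using assms(1) by (simp add: mult_le_cancel_right1)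
    finally show "1 \<le> real j * real n / real (u * v)"
      using assms(2,3) by (simp add: le_divide_eq)
  qed
  also have "\<dots> = 3 * real j * real n / real (u * v)"
    by (simp add: add_divide_distrib[symmetric] algebra_simps)
  finally show ?thesis .
qed simp

text \<open>
  Relative to one fixed solution \<open>l\<close>, every solution \<open>k\<close> satisfies \<open>d dvd (k - l) * (k + l)\<close>, so \<open>d\<close>
  splits as \<open>u * v\<close> with \<open>u dvd k - l\<close> and \<open>v dvd k + l\<close>. There are \<open>tau d\<close> such splittings.
\<close>

lemma card_square_congruence_le:
  fixes d j n :: nat
  assumes "j \<ge> 1" "1 \<le> d" "d \<le> n"
  shows "real (card {k \<in> {1..n}. int d dvd (int k)\<^sup>2 - int j})
           \<le> 3 * real j * real n * real (tau d) / real d"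
proof (cases "{k \<in> {1..n}. int d dvd (int k)\<^sup>2 - int j} = {}")
  case False
  define S where "S = {k \<in> {1..n}. int d dvd (int k)\<^sup>2 - int j}"
  obtain l where l: "int d dvd (int l)\<^sup>2 - int j" using False by auto
  define T where
    "T = (\<lambda>u. {k \<in> {1..n}. int u dvd int k - int l \<and> int (d div u) dvd int k + int l})"
  have "S \<subseteq> (\<Union>u\<in>{u. u dvd d}. T u)"
  proof
    fix k assume k: "k \<in> S"
    then have "int d dvd (int k)\<^sup>2 - int j" unfolding S_def by simp
    then have "int d dvd ((int k)\<^sup>2 - int j) - ((int l)\<^sup>2 - int j)"
      using l by (rule dvd_diff)
    then have "int d dvd (int k - int l) * (int k + int l)"
      by (simp add: power2_eq_square algebra_simps)
    then obtain u v where uv: "int d = u * v" "u dvd int k - int l" "v dvd int k + int l"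
      using division_decomp by blast
    define u' v' where "u' = nat \<bar>u\<bar>" and "v' = nat \<bar>v\<bar>"
    have d: "d = u' * v'"
    proof -
      have "d = nat \<bar>u * v\<bar>" using uv(1) by (metis abs_of_nat nat_int)
      then show ?thesis unfolding u'_def v'_def by (simp add: nat_abs_mult_distrib)
    qed
    have "u' > 0" using d assms(2) by (intro Nat.gr0I) auto
    then have "d div u' = v'" using d by simp
    then have "k \<in> T u'"
      using k uv(2,3) unfolding T_def S_def u'_def v'_def by auto
    moreover have "u' dvd d" using d by simp
    ultimately show "k \<in> (\<Union>u\<in>{u. u dvd d}. T u)" by blast
  qed
  then have "card S \<le> card (\<Union>u\<in>{u. u dvd d}. T u)"
    using assms by (intro card_mono) (auto simp: T_def)
  also have "\<dots> \<le> (\<Sum>u | u dvd d. card (T u))"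
    using assms by (intro card_UN_le) auto
  finally have "real (card S) \<le> (\<Sum>u | u dvd d. real (card (T u)))"
    by (simp flip: of_nat_sum)
  also have "\<dots> \<le> (\<Sum>u | u dvd d. 3 * real j * real n / real d)"
  proof (rule sum_mono)
    fix u assume "u \<in> {u. u dvd d}"
    then obtain v where d: "d = u * v" by blast
    then have "u > 0" "v > 0" using assms(2) by (auto intro!: Nat.gr0I)
    then show "real (card (T u)) \<le> 3 * real j * real n / real d"
      using card_split_congruence_le[of j u v n l] assms l d unfolding T_def by simp
  qed
  also have "\<dots> = 3 * real j * real n * real (tau d) / real d"
    by (simp add: tau_def)
  finally show ?thesis unfolding S_def .
next
  case True
  show ?thesis unfolding True by simp
qed

section \<open>Moments over shifted squares\<close>

text \<open>
  The small divisors \<open>d\<close> of \<open>k\<^sup>2 - j\<close> satisfy \<open>d\<^sup>2 \<le> k\<^sup>2 - j < n\<^sup>2\<close>, so after the summations are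
  exchanged every modulus is in the range where the count of solutions is proportional to \<open>n / d\<close>.
\<close>

lemma sum_tau_power_shifted_squares:
  fixes j n N :: nat
  assumes "j \<ge> 1" "n \<ge> 1"
  shows "(\<Sum>k | k \<in> {1..n} \<and> j < k\<^sup>2. real (tau (k\<^sup>2 - j)) ^ N)
           \<le> 3 * 2 ^ N * real j * real n * (1 + ln (real n)) ^ (2 ^ (2 * N + 1))"
proof -
  define Q where "Q = {k \<in> {1..n}. j < k\<^sup>2}"
  define t where "t = (\<lambda>d. real (tau d) ^ (2 * N))"
  have Q: "finite Q" unfolding Q_def by simp
  have "(\<Sum>k\<in>Q. real (tau (k\<^sup>2 - j)) ^ N)
      \<le> (\<Sum>k\<in>Q. 2 ^ N * (\<Sum>d | d \<in> {1..n} \<and> d dvd k\<^sup>2 - j. t d))"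
  proof (rule sum_mono)
    fix k assume k: "k \<in> Q"
    then have pos: "k\<^sup>2 - j > 0" and kn: "k \<le> n" unfolding Q_def by auto
    have "(\<Sum>d | d dvd k\<^sup>2 - j \<and> d\<^sup>2 \<le> k\<^sup>2 - j. t d) \<le> (\<Sum>d | d \<in> {1..n} \<and> d dvd k\<^sup>2 - j. t d)"
    proof (rule sum_mono2)
      show "{d. d dvd k\<^sup>2 - j \<and> d\<^sup>2 \<le> k\<^sup>2 - j} \<subseteq> {d \<in> {1..n}. d dvd k\<^sup>2 - j}"
      proof clarify
        fix d assume d: "d dvd k\<^sup>2 - j" "d\<^sup>2 \<le> k\<^sup>2 - j"
        have "d\<^sup>2 \<le> k\<^sup>2" using d(2) by linarith
        then have "d \<le> k" by simp
        moreover have "d > 0" using d(1) pos by (auto intro!: Nat.gr0I)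
        ultimately show "d \<in> {1..n}" using kn by auto
      qed
    qed (auto simp: t_def)
    then show "real (tau (k\<^sup>2 - j)) ^ N \<le> 2 ^ N * (\<Sum>d | d \<in> {1..n} \<and> d dvd k\<^sup>2 - j. t d)"
      using tau_power_le_sum_small_divisors[OF pos, of N] unfolding t_def
      by (smt (verit) mult_left_mono zero_le_power)
  qed
  also have "\<dots> = 2 ^ N * (\<Sum>d=1..n. \<Sum>k | k \<in> Q \<and> d dvd k\<^sup>2 - j. t d)"
    unfolding sum_distrib_left[symmetric] using Q by (subst sum.swap_restrict) auto
  also have "\<dots> \<le> 2 ^ N * (\<Sum>d=1..n. (3 * real j * real n) * (real (tau d) ^ (2 * N + 1) / real d))"
  proof (intro mult_left_mono sum_mono)
    fix d assume d: "d \<in> {1..n}"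
    have sub: "{k. k \<in> Q \<and> d dvd k\<^sup>2 - j} \<subseteq> {k \<in> {1..n}. int d dvd (int k)\<^sup>2 - int j}"
    proof clarify
      fix k assume k: "k \<in> Q" "d dvd k\<^sup>2 - j"
      then have "int (k\<^sup>2 - j) = (int k)\<^sup>2 - int j"
        unfolding Q_def by (simp add: of_nat_diff)
      moreover have "int d dvd int (k\<^sup>2 - j)" using k(2) of_nat_dvd_iff by blast
      ultimately show "k \<in> {1..n} \<and> int d dvd (int k)\<^sup>2 - int j"
        using k(1) unfolding Q_def by auto
    qed
    have "(\<Sum>k | k \<in> Q \<and> d dvd k\<^sup>2 - j. t d) = real (card {k. k \<in> Q \<and> d dvd k\<^sup>2 - j}) * t d"
      by simp
    also have "\<dots> \<le> real (card {k \<in> {1..n}. int d dvd (int k)\<^sup>2 - int j}) * t d"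
      using sub by (intro mult_right_mono of_nat_mono card_mono) (auto simp: t_def)
    also have "\<dots> \<le> (3 * real j * real n * real (tau d) / real d) * t d"
      using d assms(1) by (intro mult_right_mono card_square_congruence_le) (auto simp: t_def)
    also have "\<dots> = (3 * real j * real n) * (real (tau d) ^ (2 * N + 1) / real d)"
      by (simp add: t_def)
    finally show "(\<Sum>k | k \<in> Q \<and> d dvd k\<^sup>2 - j. t d)
      \<le> (3 * real j * real n) * (real (tau d) ^ (2 * N + 1) / real d)" .
  qed auto
  also have "\<dots> = 2 ^ N * (3 * real j * real n) * (\<Sum>d=1..n. real (tau d) ^ (2 * N + 1) / real d)"
    by (simp only: sum_distrib_left[symmetric] mult.assoc)
  also have "\<dots> \<le> 2 ^ N * (3 * real j * real n) * (1 + ln (real n)) ^ (2 ^ (2 * N + 1))"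
    by (intro mult_left_mono sum_tau_power_over_le assms(2)) auto
  finally show ?thesis unfolding Q_def by (simp add: mult_ac)
qed

section \<open>Moments of the counting function\<close>

text \<open>
  Removing the largest element \<open>b\<close> lowers the left side by at most \<open>(M + 1) * (card A)\<^sup>M\<close> and the
  right side by \<open>(M + 1) * b\<^sup>M\<close>, and \<open>b \<ge> card A\<close> because the elements are positive.
\<close>

lemma card_power_le_sum_power:
  fixes A :: "nat set"
  assumes "finite A" "0 \<notin> A"
  shows "real (card A) ^ Suc M \<le> real (Suc M) * (\<Sum>j\<in>A. real j ^ M)"
  using assms
proof (induction A rule: finite_linorder_max_induct)
  case (insert b A)
  have bA: "b \<notin> A" using insert.hyps(2) by auto
  define c where "c = real (card A)"
  have "A \<subseteq> {1..<b}"
    using insert.hyps(2) insert.prems by (auto simp: Suc_le_eq intro: Nat.gr0I)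
  then have "card A \<le> card {1..<b}" by (intro card_mono) auto
  moreover have "b > 0" using insert.prems by auto
  ultimately have "card A + 1 \<le> b" by simp
  then have cb: "c + 1 \<le> real b" unfolding c_def by linarith
  have "(c + 1) ^ Suc M - c ^ Suc M = (\<Sum>i<Suc M. c ^ (M - i) * (c + 1) ^ i)"
    by (subst power_diff_sumr2) (auto simp: c_def)
  also have "\<dots> \<le> (\<Sum>i<Suc M. real b ^ M)"
  proof (rule sum_mono)
    fix i assume i: "i \<in> {..<Suc M}"
    have "c ^ (M - i) * (c + 1) ^ i \<le> real b ^ (M - i) * real b ^ i"
      using cb by (intro mult_mono power_mono) (auto simp: c_def)
    also have "\<dots> = real b ^ M" using i by (simp flip: power_add)
    finally show "c ^ (M - i) * (c + 1) ^ i \<le> real b ^ M" .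
  qed
  also have "\<dots> = real (Suc M) * real b ^ M" by simp
  finally have "(c + 1) ^ Suc M \<le> c ^ Suc M + real (Suc M) * real b ^ M" by linarith
  also have "\<dots> \<le> real (Suc M) * (\<Sum>j\<in>A. real j ^ M) + real (Suc M) * real b ^ M"
    using insert.IH insert.prems unfolding c_def by auto
  finally have "(c + 1) ^ Suc M \<le> real (Suc M) * (\<Sum>j\<in>insert b A. real j ^ M)"
    using bA insert.hyps(1) by (simp add: algebra_simps)
  moreover have "real (card (insert b A)) = c + 1"
    using bA insert.hyps(1) by (simp add: c_def)
  ultimately show ?case by simp
qed simp

lemma finite_J: "finite (J k)"
  by (rule finite_subset[of _ "{..2 * k - 2}"]) (auto simp: J_def)

lemma card_E_le_a: "card (E k) \<le> a k"
proof -
  have "E k = (\<lambda>j. int (tau (k\<^sup>2 - j)) - int j) ` J k" unfolding E_def by auto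
  then show ?thesis unfolding a_def by (simp add: card_image_le finite_J)
qed

lemma shift_less_square:
  assumes "2 \<le> k" "j \<le> 2 * k - 2"
  shows "j < (k::nat)\<^sup>2"
proof -
  have "0 \<le> (int k - 1)\<^sup>2" by simp
  then have "2 * int k - 1 \<le> (int k)\<^sup>2" by (simp add: power2_eq_square algebra_simps)
  then have "int (2 * k) \<le> int (k\<^sup>2) + 1" by simp
  then show ?thesis using assms by linarith
qed

text \<open>
  On \<open>J k\<close> the quotient \<open>tau (k\<^sup>2 - j) / j\<close> is at least \<open>1\<close>; its power \<open>M + 3\<close> turns \<open>j\<^sup>M\<close> into \<open>j\<^sup>-\<^sup>3\<close>.
  Two of these three powers make the sum over \<open>j\<close> converge, and the third pays for the
  factor \<open>j\<close> in the moment bound.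
\<close>

lemma a_power_le:
  assumes "2 \<le> k" "k \<le> n"
  shows "real (a k) ^ Suc M
    \<le> real (Suc M) * (\<Sum>j | j \<in> {1..2 * n} \<and> j < k\<^sup>2. real (tau (k\<^sup>2 - j)) ^ (M + 3) / real j ^ 3)"
proof -
  have "real (a k) ^ Suc M \<le> real (Suc M) * (\<Sum>j\<in>J k. real j ^ M)"
    unfolding a_def by (intro card_power_le_sum_power finite_J) (auto simp: J_def)
  also have "(\<Sum>j\<in>J k. real j ^ M) \<le> (\<Sum>j\<in>J k. real (tau (k\<^sup>2 - j)) ^ (M + 3) / real j ^ 3)"
  proof (rule sum_mono)
    fix j assume j: "j \<in> J k"
    then have "real j ^ (M + 3) \<le> real (tau (k\<^sup>2 - j)) ^ (M + 3)"
      by (intro power_mono) (auto simp: J_def)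
    moreover have "real j > 0" using j by (auto simp: J_def)
    ultimately show "real j ^ M \<le> real (tau (k\<^sup>2 - j)) ^ (M + 3) / real j ^ 3"
      by (simp add: le_divide_eq power_add)
  qed
  also have "\<dots> \<le> (\<Sum>j | j \<in> {1..2 * n} \<and> j < k\<^sup>2. real (tau (k\<^sup>2 - j)) ^ (M + 3) / real j ^ 3)"
    using assms shift_less_square[OF assms(1)] by (intro sum_mono2) (auto simp: J_def)
  finally show ?thesis by (simp add: mult_left_mono)
qed

lemma sum_a_power_le:
  assumes "n \<ge> 1"
  shows "(\<Sum>k=2..n. real (a k) ^ Suc M)
    \<le> 6 * real (Suc M) * 2 ^ (M + 3) * real n * (1 + ln (real n)) ^ (2 ^ (2 * (M + 3) + 1))"
proof -
  define f where "f = (\<lambda>k j. real (tau (k\<^sup>2 - j)) ^ (M + 3) / real j ^ 3)"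
  define R where "R = 3 * 2 ^ (M + 3) * real n * (1 + ln (real n)) ^ (2 ^ (2 * (M + 3) + 1))"
  have R0: "R \<ge> 0" unfolding R_def using assms by simp
  have "(\<Sum>k=2..n. real (a k) ^ Suc M)
      \<le> (\<Sum>k=2..n. real (Suc M) * (\<Sum>j | j \<in> {1..2 * n} \<and> j < k\<^sup>2. f k j))"
    unfolding f_def by (intro sum_mono a_power_le) auto
  also have "\<dots> \<le> (\<Sum>k=1..n. real (Suc M) * (\<Sum>j | j \<in> {1..2 * n} \<and> j < k\<^sup>2. f k j))"
    by (intro sum_mono2 mult_nonneg_nonneg sum_nonneg) (auto simp: f_def)
  also have "\<dots> = real (Suc M) * (\<Sum>j=1..2 * n. \<Sum>k | k \<in> {1..n} \<and> j < k\<^sup>2. f k j)"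
    unfolding sum_distrib_left[symmetric] by (subst sum.swap_restrict) auto
  also have "\<dots> \<le> real (Suc M) * (\<Sum>j=1..2 * n. R * (1 / (real j)\<^sup>2))"
  proof (intro mult_left_mono sum_mono)
    fix j assume j: "j \<in> {1..2 * n}"
    have "(\<Sum>k | k \<in> {1..n} \<and> j < k\<^sup>2. f k j)
        = (\<Sum>k | k \<in> {1..n} \<and> j < k\<^sup>2. real (tau (k\<^sup>2 - j)) ^ (M + 3)) / real j ^ 3"
      unfolding f_def by (simp add: sum_divide_distrib)
    also have "\<dots> \<le> (R * real j) / real j ^ 3"
      using sum_tau_power_shifted_squares[of j n "M + 3"] j assms
      by (intro divide_right_mono) (auto simp: R_def mult_ac)
    also have "\<dots> = R * (1 / (real j)\<^sup>2)"
      using j by (simp add: power3_eq_cube power2_eq_square)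
    finally show "(\<Sum>k | k \<in> {1..n} \<and> j < k\<^sup>2. f k j) \<le> R * (1 / (real j)\<^sup>2)" .
  qed auto
  also have "\<dots> = real (Suc M) * (R * (\<Sum>j=1..2 * n. 1 / (real j)\<^sup>2))"
    by (simp only: sum_distrib_left)
  also have "\<dots> \<le> real (Suc M) * (R * 2)"
  proof -
    have "(\<Sum>j=1..2 * n. 1 / (real j)\<^sup>2) \<le> 2 - 1 / real (2 * n)"
      using assms by (intro sum_inverse_squares_le) auto
    also have "\<dots> \<le> 2" by simp
    finally show ?thesis using R0 by (intro mult_left_mono) auto
  qed
  also have "real (Suc M) * (R * 2)
    = 6 * real (Suc M) * 2 ^ (M + 3) * real n * (1 + ln (real n)) ^ (2 ^ (2 * (M + 3) + 1))"
    unfolding R_def by simp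
  finally show ?thesis .
qed

theorem theorem8p23:
  fixes m :: nat
  assumes "m \<ge> 2"
  shows "\<exists>C::real. C \<ge> 0 \<and> (\<exists>B::real. B > 0 \<and> (\<forall>K::real. K \<ge> 2 \<longrightarrow>
    (\<Sum>k | 2 \<le> k \<and> real k \<le> K. real (card (E k)) ^ m)
      \<le> (\<Sum>k | 2 \<le> k \<and> real k \<le> K. real (a k) ^ m) \<and>
    (\<Sum>k | 2 \<le> k \<and> real k \<le> K. real (a k) ^ m)
      \<le> B * K * (ln K) powr C))"
proof -
  obtain M where m: "m = Suc M" using assms by (cases m) auto
  define c :: nat where "c = 2 ^ (2 * (M + 3) + 1)"
  define D where "D = 6 * real (Suc M) * 2 ^ (M + 3)"
  have D: "D > 0" unfolding D_def by simp
  have first: "(\<Sum>k | 2 \<le> k \<and> real k \<le> K. real (card (E k)) ^ m)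
      \<le> (\<Sum>k | 2 \<le> k \<and> real k \<le> K. real (a k) ^ m)" for K :: real
    by (intro sum_mono power_mono of_nat_mono card_E_le_a) auto
  have second: "(\<Sum>k | 2 \<le> k \<and> real k \<le> K. real (a k) ^ m)
      \<le> (D * 3 ^ c) * K * (ln K) powr (real c)" if K: "K \<ge> 2" for K :: real
  proof -
    define n where "n = nat \<lfloor>K\<rfloor>"
    have n: "n \<ge> 1" "real n \<le> K" using K unfolding n_def by linarith+
    have set: "{k. 2 \<le> k \<and> real k \<le> K} = {2..n}"
      unfolding n_def using K by (auto simp: le_nat_iff le_floor_iff)
    \<comment> \<open>Since \<open>ln 2 \<ge> 1 / 2\<close>, the summand \<open>1\<close> is absorbed at the cost of a factor \<open>3\<close>.\<close>
    have "ln (1 / 2 :: real) \<le> 1 / 2 - 1" by (intro ln_le_minus_one) simp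
    then have "ln (2::real) \<ge> 1 / 2" by (simp add: ln_div)
    moreover have "ln 2 \<le> ln K" using K by simp
    ultimately have lnK: "ln K \<ge> 1 / 2" by linarith
    have "ln (real n) \<le> ln K" using n by simp
    then have ln3: "1 + ln (real n) \<le> 3 * ln K" using lnK by linarith
    have "(\<Sum>k | 2 \<le> k \<and> real k \<le> K. real (a k) ^ m) \<le> D * real n * (1 + ln (real n)) ^ c"
      using sum_a_power_le[OF n(1), of M] unfolding set m c_def D_def .
    also have "\<dots> \<le> D * K * (3 * ln K) ^ c"
      using n ln3 D K lnK by (intro mult_mono power_mono mult_left_mono) auto
    also have "\<dots> = (D * 3 ^ c) * K * (ln K) powr (real c)"
      using lnK by (simp add: power_mult_distrib powr_realpow)
    finally show ?thesis .
  qed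
  show ?thesis
    using first second D
    by (intro exI[of _ "real c"] conjI exI[of _ "D * 3 ^ c"]) auto
qed

end
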